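(* Let $G_\bullet$ be a vertex-stable $\mathrm{FI}$-graph of stable degree at most $d$. Then for any graph $T$ the function $$n \mapsto |\mathrm{Hom}(T,G_n)|,$$ where $\mathrm{Hom}(T,G_n)$ is the set of graph homomorphisms from $T$ to $G_n$, agrees with a polynomial of degree at most $|V(T)|\cdot d$ for all $n \gg 0$.
   Context: Graphs are finite and simple (no multi-edges, no self-loops), possibly disconnected. A homomorphism of graphs $\phi:G\to G'$ is a map $V(G)\to V(G')$ such that $\{x,y\}\in E(G)$ implies $\{\phi(x),\phi(y)\}\in E(G')$. Let $[n]=\{1,\dots,n\}$, and let $\mathrm{FI}$ be the category with objects $[n]$, $n\ge 0$, and morphisms all injections. An $\mathrm{FI}$-graph $G_\bullet$ is a functor from $\mathrm{FI}$ to the category of graphs and graph homomorphisms; $G_n$ is its value on $[n]$ and $G(f)$ is the map induced by an injection $f$. $G_\bullet$ is vertex-stable with stable degree $\le d$ if for all $n\ge d$ and every $v\in V(G_{n+1})$ there exist $w\in V(G_n)$ and an injection $f:[n]\hookrightarrow[n+1]$ with $G(f)(w)=v$. "For all $n\gg 0$" means for all sufficiently large $n$. The zero polynomial is regarded as having degree at most any bound. *)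

theory Defs
  imports
    Complex_Main
    "HOL-Library.FuncSet"
    "HOL-Computational_Algebra.Polynomial"
    "Graph_Theory.Pair_Digraph"
begin

text \<open>
  A finite simple graph is a \<^term>\<open>pair_graph\<close>: a finite vertex set with a symmetric,
  irreflexive arc relation, the edge \<open>{x, y}\<close> being present iff \<open>(x, y)\<close> (equivalently \<open>(y, x)\<close>)
  is in \<^term>\<open>parcs G\<close>. All morphisms below are extensional functions
  (\<^term>\<open>undefined\<close> outside their domain), so that equality of
  morphisms is equality in HOL and sets of morphisms have the right cardinality.
\<close>

definition graph_homs ::
  "'a pair_pre_digraph \<Rightarrow> 'b pair_pre_digraph \<Rightarrow> ('a \<Rightarrow> 'b) set" where
  "graph_homs G H =
     {\<phi> \<in> pverts G \<rightarrow>\<^sub>E pverts H. \<forall>x y. (x, y) \<in> parcs G \<longrightarrow> (\<phi> x, \<phi> y) \<in> parcs H}"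

definition FI_homs :: "nat \<Rightarrow> nat \<Rightarrow> (nat \<Rightarrow> nat) set" where
  "FI_homs m n = {f \<in> {1..m} \<rightarrow>\<^sub>E {1..n}. inj_on f {1..m}}"

text \<open>
  A functor from FI to graphs: \<open>G n\<close> is the value on \<open>[n]\<close>, and \<open>F m n f\<close> is the map
  \<open>G m \<rightarrow> G n\<close> induced by \<open>f : [m] \<rightarrow> [n]\<close>. The codomain index \<open>n\<close> is passed
  explicitly because a HOL function does not determine its codomain.
\<close>

locale fi_graph =
  fixes G :: "nat \<Rightarrow> 'a pair_pre_digraph"
    and F :: "nat \<Rightarrow> nat \<Rightarrow> (nat \<Rightarrow> nat) \<Rightarrow> 'a \<Rightarrow> 'a"
  assumes graph_obj: "pair_graph (G n)"
    and map_hom: "f \<in> FI_homs m n \<Longrightarrow> F m n f \<in> graph_homs (G m) (G n)"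
    and map_id: "F n n (\<lambda>i\<in>{1..n}. i) = (\<lambda>v\<in>pverts (G n). v)"
    and map_comp: "\<lbrakk>f \<in> FI_homs l m; g \<in> FI_homs m n\<rbrakk> \<Longrightarrow>
      F l n (compose {1..l} g f) = compose (pverts (G l)) (F m n g) (F l m f)"

text \<open>Vertex-stable, with stable degree at most \<open>d\<close>.\<close>

definition vertex_stable ::
  "(nat \<Rightarrow> 'a pair_pre_digraph) \<Rightarrow> (nat \<Rightarrow> nat \<Rightarrow> (nat \<Rightarrow> nat) \<Rightarrow> 'a \<Rightarrow> 'a) \<Rightarrow> nat \<Rightarrow> bool" where
  "vertex_stable G F d \<longleftrightarrow>
     (\<forall>n\<ge>d. \<forall>v\<in>pverts (G (n + 1)). \<exists>w\<in>pverts (G n). \<exists>f\<in>FI_homs n (n + 1). F n (n + 1) f w = v)"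

end

theory Submission
  imports Defs
begin

text \<open>
  All vertex maps \<open>V(T) \<rightarrow> V(G\<^sub>n)\<close> form a functor \<open>X\<close> from FI to finite sets which is generated in
  degree \<open>k = |V(T)| d\<close>, since \<open>|V(T)|\<close> vertices are supported on at most \<open>k\<close> points of \<open>[n]\<close>.
  The graph homomorphisms form a subfunctor \<open>Y\<close>. It need not be generated in degree \<open>k\<close>, but the set
  \<open>C\<close> of those \<open>z \<in> X\<^sub>k\<close> whose images lie in \<open>Y\<^sub>n\<close> grows with \<open>n\<close>, so it is eventually constant,
  and \<open>Y\<^sub>n\<close> is then the image of \<open>C \<times> Inj([k], [n])\<close> under \<open>(z, f) \<mapsto> X(f) z\<close>. By symmetry the
  size \<open>N\<^sub>z(n)\<close> of the fibre through \<open>(z, f)\<close> does not depend on \<open>f\<close>, so \<open>|Y\<^sub>n|\<close> is the sum over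
  \<open>z \<in> C\<close> of \<open>|Inj([k], [n])| / N\<^sub>z(n)\<close>. Whether \<open>(z', f')\<close> lies in the fibre of \<open>z\<close> at the inclusion
  \<open>[k] \<subseteq> [n]\<close> depends only on \<open>z'\<close> and on the way \<open>f'\<close> hits \<open>[k]\<close>, again monotonically in \<open>n\<close>;
  hence \<open>N\<^sub>z\<close> is eventually an integer polynomial. So \<open>|Y\<^sub>n|\<close> is eventually a rational function
  of \<open>n\<close> with integer values, and such a function is a polynomial.
\<close>

section \<open>Integer-valued rational functions\<close>

lemma of_int_poly_eval:
  "poly (map_poly of_int p) (of_int x :: 'a::comm_ring_1) = of_int (poly p x)"
  by (induction p) (simp_all add: map_poly_pCons)

lemma int_poly_eventually_nonzero:
  fixes p :: "int poly"
  assumes "p \<noteq> 0"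
  shows "\<forall>\<^sub>F n::nat in sequentially. poly p (int n) \<noteq> 0"
proof -
  have "finite (int -` {x. poly p x = 0})"
    using poly_roots_finite[OF assms] by (intro finite_vimageI) auto
  then have "eventually (\<lambda>n. n \<notin> int -` {x. poly p x = 0}) cofinite"
    by (simp add: eventually_cofinite)
  then show ?thesis
    by (simp add: cofinite_eq_sequentially)
qed

text \<open>Over the reals the quotient of the values tends to 0, so eventually it is below 1 in
  absolute value; \<open>q\<close> is nonzero at large n, which lets the denominator be
  cleared.\<close>

lemma int_poly_eventually_less:
  fixes p q :: "int poly"
  assumes "degree p < degree q"
  shows "\<forall>\<^sub>F n::nat in sequentially. \<bar>poly p (int n)\<bar> < \<bar>poly q (int n)\<bar>"
proof -
  let ?r = "map_poly real_of_int"
  have nz: "q \<noteq> 0" using assms by auto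
  have deg: "degree (?r p) < degree (?r q)"
    using assms by (simp add: degree_map_poly)
  have "((\<lambda>n. poly (?r p) (real n) / poly (?r q) (real n)) \<longlongrightarrow> 0) sequentially"
    by (rule filterlim_compose[OF poly_divide_tendsto_0_at_infinity[OF deg]])
      (rule filterlim_compose[OF filterlim_at_top_imp_at_infinity filterlim_real_sequentially], rule filterlim_ident)
  then have "\<forall>\<^sub>F n in sequentially. \<bar>poly (?r p) (real n) / poly (?r q) (real n)\<bar> < 1"
    by (rule order_tendstoD(2)[OF tendsto_rabs_zero]) simp
  then show ?thesis
    using int_poly_eventually_nonzero[OF nz]
  proof eventually_elim
    case (elim n)
    have "poly (?r s) (real n) = of_int (poly s (int n))" for s
      using of_int_poly_eval[of s "int n", where 'a = real] by simp
    with elim show ?case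
      by (simp add: abs_divide)
  qed
qed

text \<open>Pseudo-division stays over the integers: \<open>a * P = Q * A + B\<close> with
  \<open>B\<close> zero or of smaller degree than \<open>Q\<close>. At large n the value of
  \<open>Q\<close> divides that of \<open>B\<close>, which is smaller in absolute value; so
  \<open>B = 0\<close>, and \<open>A\<close> divided by \<open>a\<close> is the desired
  polynomial.\<close>

lemma integer_valued_ratio_is_poly:
  fixes P Q :: "int poly" and c :: "nat \<Rightarrow> int"
  assumes "Q \<noteq> 0" and ev: "\<forall>\<^sub>F n in sequentially. c n * poly Q (int n) = poly P (int n)"
  shows "\<exists>p::real poly. degree p \<le> degree P - degree Q \<and>
           (\<forall>\<^sub>F n in sequentially. real_of_int (c n) = poly p (real n))"
proof -
  define B where "B = pseudo_mod P Q"
  obtain a A where a: "a \<noteq> 0" and eq: "smult a P = Q * A + B"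
    using pseudo_mod(1)[OF \<open>Q \<noteq> 0\<close>, of P] unfolding B_def by blast
  have "B = 0 \<or> degree B < degree Q"
    using pseudo_mod(2)[OF \<open>Q \<noteq> 0\<close>, of P] unfolding B_def .
  have "B = 0"
  proof (rule ccontr)
    assume "B \<noteq> 0"
    then have "degree B < degree Q"
      using \<open>B = 0 \<or> degree B < degree Q\<close> by simp
    have "\<forall>\<^sub>F n::nat in sequentially. False"
      using ev int_poly_eventually_less[OF \<open>degree B < degree Q\<close>] int_poly_eventually_nonzero[OF \<open>B \<noteq> 0\<close>]
    proof eventually_elim
      case (elim n)
      let ?q = "poly Q (int n)"
      have "a * (c n * ?q) = ?q * poly A (int n) + poly B (int n)"
        using arg_cong[OF eq, of "\<lambda>p. poly p (int n)"] elim(1) by simp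
      then have "poly B (int n) = ?q * (a * c n - poly A (int n))"
        by (simp add: algebra_simps)
      then have "?q dvd poly B (int n)" by simp
      then have "\<bar>?q\<bar> \<le> \<bar>poly B (int n)\<bar>"
        using elim(3) dvd_imp_le_int by blast
      with elim(2) show False by simp
    qed
    then show False by simp
  qed
  let ?p = "smult (1 / real_of_int a) (map_poly real_of_int A)"
  \<comment> \<open>The natural subtraction is exact for \<open>A\<close> nonzero; otherwise
    \<open>?p\<close> is the zero polynomial.\<close>
  have "degree ?p \<le> degree P - degree Q"
  proof (cases "A = 0")
    case False
    have "degree P = degree (smult a P)" using a by simp
    also have "\<dots> = degree Q + degree A"
      using eq \<open>B = 0\<close> False \<open>Q \<noteq> 0\<close> by (simp add: degree_mult_eq)
    finally have "degree A = degree P - degree Q" by simp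
    then show ?thesis by (simp add: degree_map_poly)
  qed simp
  moreover have "\<forall>\<^sub>F n in sequentially. real_of_int (c n) = poly ?p (real n)"
    using ev int_poly_eventually_nonzero[OF \<open>Q \<noteq> 0\<close>]
  proof eventually_elim
    case (elim n)
    have "poly Q (int n) * (a * c n) = poly Q (int n) * poly A (int n)"
      using arg_cong[OF eq, of "\<lambda>p. poly p (int n)"] elim(1) \<open>B = 0\<close> by (simp add: algebra_simps)
    then have "a * c n = poly A (int n)" using elim(2) by simp
    then have "real_of_int a * real_of_int (c n) = real_of_int (poly A (int n))"
      by (metis of_int_mult)
    also have "\<dots> = poly (map_poly real_of_int A) (real n)"
      using of_int_poly_eval[of A "int n", where 'a = real] by simp
    finally show ?case using a by (simp add: field_simps)
  qed
  ultimately show ?thesis by blast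
qed

section \<open>Fibre counting and stabilising chains of finite sets\<close>

text \<open>A fibre with s elements contributes s summands 1/s, so each point of the image counts
  once.\<close>

lemma card_image_sum_fibres:
  assumes "finite A"
  shows "real (card (e ` A)) = (\<Sum>a\<in>A. 1 / real (card {b\<in>A. e b = e a}))"
proof -
  have "(\<Sum>a\<in>A. 1 / real (card {b\<in>A. e b = e a})) =
      (\<Sum>y\<in>e ` A. \<Sum>a\<in>{a\<in>A. e a = y}. 1 / real (card {b\<in>A. e b = e a}))"
    by (rule sum.image_gen[OF assms])
  also have "\<dots> = (\<Sum>y\<in>e ` A. 1)"
  proof (rule sum.cong)
    fix y assume "y \<in> e ` A"
    then have "card {a\<in>A. e a = y} \<noteq> 0" using assms by auto
    then show "(\<Sum>a\<in>{a\<in>A. e a = y}. 1 / real (card {b\<in>A. e b = e a})) = 1" by simp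
  qed simp
  finally show ?thesis by simp
qed

text \<open>The union of the chain is finite, so each of its elements has entered by some common
  stage, after which nothing changes.\<close>

lemma eventually_constant_subset:
  fixes A :: "nat \<Rightarrow> 'b set"
  assumes "finite B" and "\<And>n. n \<ge> N \<Longrightarrow> A n \<subseteq> B"
    and mono: "\<And>m n. N \<le> m \<Longrightarrow> m \<le> n \<Longrightarrow> A m \<subseteq> A n"
  shows "\<exists>n0\<ge>N. \<exists>C. \<forall>n\<ge>n0. A n = C"
proof -
  define C where "C = (\<Union>n\<in>{N..}. A n)"
  have "C \<subseteq> B" using assms(2) by (auto simp: C_def)
  then have "finite C" using assms(1) finite_subset by blast
  have "\<forall>x\<in>C. \<exists>n\<ge>N. x \<in> A n" by (auto simp: C_def)
  then obtain k where k: "\<And>x. x \<in> C \<Longrightarrow> k x \<ge> N \<and> x \<in> A (k x)" by metis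
  \<comment> \<open>Inserting \<open>N\<close> covers an empty \<open>C\<close> and forces
    \<open>n0 \<ge> N\<close>.\<close>
  define n0 where "n0 = Max (insert N (k ` C))"
  have n0: "n0 \<ge> N" "\<And>x. x \<in> C \<Longrightarrow> k x \<le> n0"
    using \<open>finite C\<close> by (auto simp: n0_def)
  have "A n = C" if "n \<ge> n0" for n
  proof
    show "A n \<subseteq> C" using that n0(1) unfolding C_def by fastforce
    show "C \<subseteq> A n" using k n0 mono that by (meson order_trans subset_iff)
  qed
  with n0(1) show ?thesis by blast
qed

section \<open>Injections and their patterns\<close>

lemma FI_homsI:
  assumes "f \<in> {1..m} \<rightarrow>\<^sub>E {1..n}" "inj_on f {1..m}"
  shows "f \<in> FI_homs m n"
  using assms by (simp add: FI_homs_def)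

lemma FI_homsD:
  assumes "f \<in> FI_homs m n"
  shows "f \<in> {1..m} \<rightarrow>\<^sub>E {1..n}" "inj_on f {1..m}"
  using assms by (simp_all add: FI_homs_def)

lemma FI_homs_mem: "f \<in> FI_homs m n \<Longrightarrow> i \<in> {1..m} \<Longrightarrow> f i \<in> {1..n}"
  using FI_homsD(1) by blast

lemma finite_FI_homs: "finite (FI_homs m n)"
  by (rule finite_subset[of _ "{1..m} \<rightarrow>\<^sub>E {1..n}"]) (auto simp: FI_homs_def intro: finite_PiE)

lemma FI_homs_eqI:
  assumes "f \<in> FI_homs m n" "g \<in> FI_homs m n" "\<And>i. i \<in> {1..m} \<Longrightarrow> f i = g i"
  shows "f = g"
  using assms by (meson FI_homsD(1) PiE_ext)

lemma FI_homs_compose: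
  assumes "f \<in> FI_homs l m" "g \<in> FI_homs m n"
  shows "compose {1..l} g f \<in> FI_homs l n"
proof (rule FI_homsI)
  show "compose {1..l} g f \<in> {1..l} \<rightarrow>\<^sub>E {1..n}"
    using FI_homs_mem[OF assms(2) FI_homs_mem[OF assms(1)]] by (auto simp: compose_def)
  show "inj_on (compose {1..l} g f) {1..l}"
    using FI_homsD(2)[OF assms(1)] FI_homsD(2)[OF assms(2)] FI_homs_mem[OF assms(1)]
    unfolding inj_on_def compose_eq by (metis compose_eq)
qed

lemma FI_homs_inclusion: "m \<le> n \<Longrightarrow> (\<lambda>i\<in>{1..m}. i) \<in> FI_homs m n"
  by (auto intro!: FI_homsI simp: inj_on_def)

text \<open>An extensional function does not record its codomain, so enlarging the codomain leaves
  it unchanged. Sets of injections at different levels can thus be compared by plain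
  inclusion.\<close>

lemma FI_homs_compose_inclusion:
  assumes "f \<in> FI_homs l m"
  shows "compose {1..l} (\<lambda>i\<in>{1..m}. i) f = f"
  using FI_homs_mem[OF assms] FI_homsD(1)[OF assms] 
  by (intro ext) (auto simp: compose_def restrict_def PiE_iff extensional_def)

text \<open>The complements of \<open>A\<close> and of its image have equal size, so a bijection
  between them completes \<open>h\<close> to a permutation of [n].\<close>

lemma FI_homs_extend:
  assumes "A \<subseteq> {1..n}" "h ` A \<subseteq> {1..n}" "inj_on h A"
  shows "\<exists>g\<in>FI_homs n n. \<forall>a\<in>A. g a = h a"
proof -
  have fin: "finite A" using assms(1) finite_subset by blast
  have "card ({1..n} - A) = card ({1..n} - h ` A)"
    using fin assms by (simp add: card_Diff_subset card_image)
  then obtain k where k: "bij_betw k ({1..n} - A) ({1..n} - h ` A)"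
    using finite_same_card_bij by blast
  define g where "g = (\<lambda>i\<in>{1..n}. if i \<in> A then h i else k i)"
  have "bij_betw g (A \<union> ({1..n} - A)) (h ` A \<union> ({1..n} - h ` A))"
  proof (rule bij_betw_combine)
    show "bij_betw g A (h ` A)"
      using assms(1,3) by (subst bij_betw_cong[of A g h]) (auto simp: g_def bij_betw_def)
    show "bij_betw g ({1..n} - A) ({1..n} - h ` A)"
      using k by (subst bij_betw_cong[of _ g k]) (auto simp: g_def)
  qed auto
  moreover have "A \<union> ({1..n} - A) = {1..n}" "h ` A \<union> ({1..n} - h ` A) = {1..n}"
    using assms by auto
  ultimately have "bij_betw g {1..n} {1..n}" by simp
  moreover have "g \<in> extensional {1..n}" by (simp add: g_def)
  ultimately have "g \<in> FI_homs n n"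
    by (simp add: FI_homs_def PiE_iff bij_betw_imp_inj_on bij_betw_apply del: One_nat_def atLeastAtMost_iff)
  moreover have "g a = h a" if "a \<in> A" for a
    using that assms(1) by (auto simp: g_def)
  ultimately show ?thesis by blast
qed

text \<open>
  The value \<open>0\<close> marks the arguments that an injection sends outside of \<open>[k]\<close>.
\<close>

definition FI_pattern :: "nat \<Rightarrow> (nat \<Rightarrow> nat) \<Rightarrow> nat \<Rightarrow> nat" where
  "FI_pattern k f = (\<lambda>i\<in>{1..k}. if f i \<le> k then f i else 0)"

lemma FI_pattern_eqD:
  assumes "FI_pattern k f = FI_pattern k f'" "i \<in> {1..k}"
  shows "(if f i \<le> k then f i else 0) = (if f' i \<le> k then f' i else 0)"
  using fun_cong[OF assms(1), of i] assms(2) by (simp add: FI_pattern_def)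

text \<open>Equal patterns make the prescription "fix [k] and send \<open>f i\<close> to
  \<open>f' i\<close>" consistent and injective, so it extends to a permutation of [n].\<close>

lemma FI_pattern_transitive:
  assumes f: "f \<in> FI_homs k n" and f': "f' \<in> FI_homs k n" and "k \<le> n"
    and pat: "FI_pattern k f = FI_pattern k f'"
  obtains g where "g \<in> FI_homs n n" "\<And>i. i \<in> {1..k} \<Longrightarrow> g i = i" "compose {1..k} g f = f'"
proof -
  define h where "h x = (if x \<in> {1..k} then x else f' (inv_into {1..k} f x))" for x
  \<comment> \<open>Only \<open>f i\<close> in [k] needs care: it is at least 1, so it differs from
    the marker 0, and equality of patterns gives \<open>f' i = f i\<close>.\<close>
  have hf: "h (f i) = f' i" if "i \<in> {1..k}" for i
    using that FI_pattern_eqD[OF pat that] FI_homsD(2)[OF f] FI_homs_mem[OF f that]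
    by (auto simp: h_def inv_into_f_f split: if_splits)
  have small: "f' i \<le> k \<longleftrightarrow> f i \<le> k" if "i \<in> {1..k}" for i
    using FI_pattern_eqD[OF pat that] FI_homs_mem[OF f that] FI_homs_mem[OF f' that]
    by (auto split: if_splits)
  have "\<exists>g\<in>FI_homs n n. \<forall>a\<in>{1..k} \<union> f ` {1..k}. g a = h a"
  proof (rule FI_homs_extend)
    show "{1..k} \<union> f ` {1..k} \<subseteq> {1..n}"
      using \<open>k \<le> n\<close> FI_homs_mem[OF f] by auto
    show "h ` ({1..k} \<union> f ` {1..k}) \<subseteq> {1..n}"
      using \<open>k \<le> n\<close> FI_homs_mem[OF f'] by (auto simp: hf) (auto simp: h_def)
    have 1: "inj_on h {1..k}" by (auto simp: h_def inj_on_def)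
    have 2: "inj_on h (f ` {1..k})"
      by (rule inj_on_imageI, subst inj_on_cong[where g = f']) (simp_all add: hf FI_homsD(2)[OF f'] del: One_nat_def)
    show "inj_on h ({1..k} \<union> f ` {1..k})"
      unfolding inj_on_Un
    proof (intro conjI 1 2)
      \<comment> \<open>Here \<open>y\<close> is some \<open>f i > k\<close> and goes to
        \<open>f' i > k\<close>, whereas \<open>x\<close> stays in [k].\<close>
      have "h x \<noteq> h y" if xy: "x \<in> {1..k} - f ` {1..k}" "y \<in> f ` {1..k} - {1..k}" for x y
      proof -
        obtain i where i: "i \<in> {1..k}" "y = f i" using xy(2) by blast
        have "f i > k" using xy(2) i FI_homs_mem[OF f i(1)] by auto
        then have "h y > k" using hf[OF i(1)] small[OF i(1)] i(2) by auto
        moreover have "h x \<le> k" using xy(1) by (auto simp: h_def)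
        ultimately show ?thesis by simp
      qed
      then show "h ` ({1..k} - f ` {1..k}) \<inter> h ` (f ` {1..k} - {1..k}) = {}" by blast
    qed
  qed
  then obtain g where g: "g \<in> FI_homs n n" "\<And>a. a \<in> {1..k} \<union> f ` {1..k} \<Longrightarrow> g a = h a"
    by blast
  have "compose {1..k} g f = f'"
    by (rule FI_homs_eqI[OF FI_homs_compose[OF f g(1)] f']) (simp add: compose_eq g(2) hf)
  moreover have "g i = i" if "i \<in> {1..k}" for i
    using g(2)[of i] that by (auto simp: h_def)
  ultimately show ?thesis using that g(1) by blast
qed

lemma FI_homs_transitive:
  assumes f: "f \<in> FI_homs k n" and f': "f' \<in> FI_homs k n"
  obtains g where "g \<in> FI_homs n n" "compose {1..k} g f = f'"
proof -
  define h where "h x = f' (inv_into {1..k} f x)" for x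
  have hf: "h (f i) = f' i" if "i \<in> {1..k}" for i
    using that FI_homsD(2)[OF f] by (simp add: h_def inv_into_f_f)
  have "\<exists>g\<in>FI_homs n n. \<forall>a\<in>f ` {1..k}. g a = h a"
  proof (rule FI_homs_extend)
    show "f ` {1..k} \<subseteq> {1..n}" using FI_homs_mem[OF f] by auto
    show "h ` f ` {1..k} \<subseteq> {1..n}" using FI_homs_mem[OF f'] by (auto simp: hf)
    show "inj_on h (f ` {1..k})"
      by (rule inj_on_imageI, subst inj_on_cong[where g = f']) (simp_all add: hf FI_homsD(2)[OF f'] del: One_nat_def)
  qed
  then obtain g where g: "g \<in> FI_homs n n" "\<And>a. a \<in> f ` {1..k} \<Longrightarrow> g a = h a"
    by blast
  have "compose {1..k} g f = f'"
    by (rule FI_homs_eqI[OF FI_homs_compose[OF f g(1)] f']) (simp add: compose_eq g(2) hf)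
  with that g(1) show ?thesis by blast
qed

lemma bij_FI_homs_compose:
  assumes g: "g \<in> FI_homs n n"
  shows "bij_betw (compose {1..k} g) (FI_homs k n) (FI_homs k n)"
proof -
  have inj: "inj_on (compose {1..k} g) (FI_homs k n)"
  proof (rule inj_onI)
    fix f f' assume f: "f \<in> FI_homs k n" "f' \<in> FI_homs k n"
      and eq: "compose {1..k} g f = compose {1..k} g f'"
    show "f = f'"
    proof (rule FI_homs_eqI[OF f])
      fix i assume i: "i \<in> {1..k}"
      then have "g (f i) = g (f' i)" using fun_cong[OF eq, of i] by (simp add: compose_eq)
      then show "f i = f' i"
        using inj_onD[OF FI_homsD(2)[OF g]] FI_homs_mem[OF f(1) i] FI_homs_mem[OF f(2) i] by blast
    qed
  qed
  then have "compose {1..k} g ` FI_homs k n = FI_homs k n"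
    using FI_homs_compose[OF _ g] by (intro endo_inj_surj finite_FI_homs image_subsetI)
  with inj show ?thesis by (simp add: bij_betw_def)
qed

text \<open>The pattern fixes the values inside [k]; the remaining arguments, collected in
  \<open>Z\<close>, map injectively into the n - k points beyond k. Truncated subtraction makes the
  product 0 when there are too few such points. The codomain [m] of \<open>f0\<close> is arbitrary,
  as only its pattern matters.\<close>

lemma card_FI_pattern_fibre:
  assumes f0: "f0 \<in> FI_homs k m" and "k \<le> n"
  shows "card {f \<in> FI_homs k n. FI_pattern k f = FI_pattern k f0} =
    (\<Prod>i<card {i\<in>{1..k}. k < f0 i}. n - k - i)"
proof -
  define Z where "Z = {i\<in>{1..k}. k < f0 i}"
  define A where "A = {f \<in> FI_homs k n. FI_pattern k f = FI_pattern k f0}"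
  define B where "B = {h \<in> Z \<rightarrow>\<^sub>E {k+1..n}. inj_on h Z}"
  \<comment> \<open>The inverse of restriction to \<open>Z\<close>: \<open>f0\<close> supplies the
    values that the pattern prescribes.\<close>
  define \<Psi> where "\<Psi> h = (\<lambda>i\<in>{1..k}. if i \<in> Z then h i else f0 i)" for h
  have Z: "Z \<subseteq> {1..k}" "finite Z" by (auto simp: Z_def)
  have f0_le: "f0 i \<in> {1..k}" if "i \<in> {1..k} - Z" for i
    using that FI_homs_mem[OF f0, of i] by (auto simp: Z_def)
  have A_Z: "f i \<in> {k+1..n}" if "f \<in> A" "i \<in> Z" for f i
  proof -
    have i: "i \<in> {1..k}" "k < f0 i" using that(2) by (auto simp: Z_def)
    have f: "f \<in> FI_homs k n" "FI_pattern k f = FI_pattern k f0" using that(1) by (auto simp: A_def)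
    then show ?thesis
      using FI_pattern_eqD[OF f(2) i(1)] i FI_homs_mem[OF f(1) i(1)]
      by (cases "f i \<le> k") simp_all
  qed
  have A_nZ: "f i = f0 i" if "f \<in> A" "i \<in> {1..k} - Z" for f i
  proof -
    have f: "FI_pattern k f = FI_pattern k f0" using that(1) by (auto simp: A_def)
    then show ?thesis
      using FI_pattern_eqD[OF f, of i] that(2) f0_le[OF that(2)]
      by (auto split: if_splits)
  qed
  have "bij_betw (\<lambda>f. restrict f Z) A B"
  proof (rule bij_betw_byWitness[where f' = \<Psi>])
    show "\<forall>f\<in>A. \<Psi> (restrict f Z) = f"
    proof
      fix f assume f: "f \<in> A"
      then have "f \<in> extensional {1..k}" by (auto simp: A_def FI_homs_def PiE_iff)
      then show "\<Psi> (restrict f Z) = f"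
        using A_nZ[OF f] by (intro extensionalityI[where A = "{1..k}"]) (auto simp: \<Psi>_def)
    qed
    show "\<forall>h\<in>B. restrict (\<Psi> h) Z = h"
    proof
      fix h assume "h \<in> B"
      then have "h \<in> extensional Z" by (auto simp: B_def PiE_iff)
      then show "restrict (\<Psi> h) Z = h"
        using Z(1) by (intro extensionalityI[where A = Z]) (auto simp: \<Psi>_def)
    qed
    show "(\<lambda>f. restrict f Z) ` A \<subseteq> B"
    proof (rule image_subsetI)
      fix f assume f: "f \<in> A"
      then have "inj_on f Z"
        using Z(1) by (auto simp: A_def FI_homs_def intro: inj_on_subset)
      then show "restrict f Z \<in> B"
        using A_Z[OF f] by (auto simp: B_def)
    qed
    show "\<Psi> ` B \<subseteq> A"
    proof (rule image_subsetI)
      fix h assume "h \<in> B"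
      then have h: "\<And>i. i \<in> Z \<Longrightarrow> h i \<in> {k+1..n}" "inj_on h Z" by (auto simp: B_def)
      have 1: "\<Psi> h \<in> {1..k} \<rightarrow>\<^sub>E {1..n}"
        unfolding \<Psi>_def
      proof (intro restrict_PiE_iff[THEN iffD2] ballI)
        fix i assume "i \<in> {1..k}"
        then show "(if i \<in> Z then h i else f0 i) \<in> {1..n}"
          using h(1)[of i] f0_le[of i] \<open>k \<le> n\<close> by (cases "i \<in> Z") auto
      qed
      have 2: "inj_on (\<Psi> h) {1..k}"
      proof (rule inj_onI)
        fix i j assume ij: "i \<in> {1..k}" "j \<in> {1..k}" and "\<Psi> h i = \<Psi> h j"
        then have eq: "(if i \<in> Z then h i else f0 i) = (if j \<in> Z then h j else f0 j)"
          by (simp add: \<Psi>_def)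
        \<comment> \<open>The two branches cannot collide: values of \<open>h\<close> exceed k,
          those of \<open>f0\<close> off \<open>Z\<close> do not.\<close>
        show "i = j"
          using eq ij h(1)[of i] h(1)[of j] f0_le[of i] f0_le[of j]
            inj_onD[OF h(2), of i j] inj_onD[OF FI_homsD(2)[OF f0], of i j]
          by (cases "i \<in> Z"; cases "j \<in> Z") auto
      qed
      have "FI_pattern k (\<Psi> h) = FI_pattern k f0"
        unfolding FI_pattern_def
      proof (rule restrict_ext)
        fix i assume "i \<in> {1..k}"
        then show "(if \<Psi> h i \<le> k then \<Psi> h i else 0) = (if f0 i \<le> k then f0 i else 0)"
          using h(1)[of i] by (cases "i \<in> Z") (auto simp: \<Psi>_def Z_def)
      qed
      with 1 2 show "\<Psi> h \<in> A" by (simp add: A_def FI_homs_def)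
    qed
  qed
  then have "card A = card B" by (rule bij_betw_same_card)
  also have "\<dots> = (\<Prod>i<card Z. n - k - i)"
    using card_inj_on_subset_funcset[of Z "{k+1..n}" Z] Z(2)
    by (simp add: B_def lessThan_atLeast0)
  finally show ?thesis by (simp add: A_def Z_def)
qed

section \<open>Polynomial counts of families of injections\<close>

text \<open>The polynomial (x-k)(x-k-1)...(x-k-j+1); for n \<ge> k its value at n counts the
  injections of j points into [n] minus [k].\<close>

definition falling_poly :: "nat \<Rightarrow> nat \<Rightarrow> int poly" where
  "falling_poly k j = (\<Prod>i<j. [:- int (k + i), 1:])"

lemma degree_falling_poly: "degree (falling_poly k j) = j"
  unfolding falling_poly_def by (subst degree_prod_sum_eq) auto

lemma poly_falling_poly:
  assumes "k + j \<le> n"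
  shows "poly (falling_poly k j) (int n) = int (\<Prod>i<j. n - k - i)"
proof -
  have "poly (falling_poly k j) (int n) = (\<Prod>i<j. int n - int (k + i))"
    by (simp add: falling_poly_def poly_prod algebra_simps)
  also have "\<dots> = (\<Prod>i<j. int (n - k - i))"
    using assms by (intro prod.cong) (auto simp: of_nat_diff)
  finally show ?thesis by simp
qed

text \<open>Closure under injections fixing [k] makes \<open>S n\<close> a union of full pattern
  classes and lets its set of patterns grow with n. There are finitely many patterns, so this set
  stabilises, and each pattern then contributes one falling factorial of degree at most k.\<close>

lemma card_FI_closed_poly:
  fixes S :: "nat \<Rightarrow> (nat \<Rightarrow> nat) set"
  assumes sub: "\<And>n. S n \<subseteq> FI_homs k n"
    and closed: "\<And>m n f g. \<lbrakk>k \<le> m; f \<in> S m; g \<in> FI_homs m n; \<And>i. i \<in> {1..k} \<Longrightarrow> g i = i\<rbrakk>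
      \<Longrightarrow> compose {1..k} g f \<in> S n"
  shows "\<exists>q::int poly. degree q \<le> k \<and> (\<forall>\<^sub>F n in sequentially. int (card (S n)) = poly q (int n))"
proof -
  have mono: "S m \<subseteq> S n" if "k \<le> m" "m \<le> n" for m n
  proof
    fix f assume f: "f \<in> S m"
    have "compose {1..k} (\<lambda>i\<in>{1..m}. i) f \<in> S n"
      using that by (intro closed[OF _ f FI_homs_inclusion]) auto
    then show "f \<in> S n"
      using FI_homs_compose_inclusion[of f k m] f sub by (metis subset_iff)
  qed
  have "finite ({1..k} \<rightarrow>\<^sub>E {0..k})" by (intro finite_PiE) auto
  moreover have "FI_pattern k ` S n \<subseteq> {1..k} \<rightarrow>\<^sub>E {0..k}" for n
    by (auto simp: FI_pattern_def)
  moreover have "FI_pattern k ` S m \<subseteq> FI_pattern k ` S n" if "k \<le> m" "m \<le> n" for m n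
    using mono[OF that] by (rule image_mono)
  ultimately have "\<exists>n0\<ge>k. \<exists>P. \<forall>n\<ge>n0. FI_pattern k ` S n = P"
    by (rule eventually_constant_subset)
  then obtain P n0 where n0: "n0 \<ge> k" "\<And>n. n \<ge> n0 \<Longrightarrow> FI_pattern k ` S n = P"
    by blast
  have "finite P"
    using n0(2)[of n0] finite_subset[OF sub finite_FI_homs] by blast
  have "\<forall>p\<in>P. \<exists>f0. f0 \<in> S n0 \<and> FI_pattern k f0 = p" using n0(2)[of n0] by auto
  then obtain r where r: "\<And>p. p \<in> P \<Longrightarrow> r p \<in> S n0" "\<And>p. p \<in> P \<Longrightarrow> FI_pattern k (r p) = p"
    by metis
  define z where "z p = card {i\<in>{1..k}. k < r p i}" for p
  have z: "z p \<le> k" for p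
  proof -
    have "card {i\<in>{1..k}. k < r p i} \<le> card {1..k}" by (rule card_mono) auto
    then show ?thesis by (simp add: z_def)
  qed
  let ?q = "\<Sum>p\<in>P. falling_poly k (z p)"
  \<comment> \<open>Since \<open>z p \<le> k\<close>, the bound 2k keeps all the factors of the
    falling factorials free of truncation.\<close>
  have "int (card (S n)) = poly ?q (int n)" if n: "n \<ge> max n0 (2 * k)" for n
  proof -
    have "k \<le> n" using n by simp
    \<comment> \<open>A pattern class that meets \<open>S n\<close> lies inside it, because
      permutations fixing [k] act transitively on the class.\<close>
    have S_eq: "{f \<in> S n. FI_pattern k f = p} = {f \<in> FI_homs k n. FI_pattern k f = p}" if pP: "p \<in> P" for p
    proof
      show "{f \<in> S n. FI_pattern k f = p} \<subseteq> {f \<in> FI_homs k n. FI_pattern k f = p}"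
        using sub by auto
      show "{f \<in> FI_homs k n. FI_pattern k f = p} \<subseteq> {f \<in> S n. FI_pattern k f = p}"
      proof clarify
        fix f assume f: "f \<in> FI_homs k n" "p = FI_pattern k f"
        then obtain f' where f': "f' \<in> S n" "FI_pattern k f' = FI_pattern k f"
          using n0(2)[of n] n pP by auto
        obtain g where "g \<in> FI_homs n n" "\<And>i. i \<in> {1..k} \<Longrightarrow> g i = i" "compose {1..k} g f' = f"
          using FI_pattern_transitive[OF _ f(1) \<open>k \<le> n\<close> f'(2)] sub f'(1) by blast
        then show "f \<in> S n \<and> FI_pattern k f = FI_pattern k f"
          using closed[OF \<open>k \<le> n\<close> f'(1)] by blast
      qed
    qed
    have "card (S n) = (\<Sum>f\<in>S n. 1)" by simp
    also have "\<dots> = (\<Sum>p\<in>FI_pattern k ` S n. \<Sum>f\<in>{f\<in>S n. FI_pattern k f = p}. 1)"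
      by (rule sum.image_gen[OF finite_subset[OF sub finite_FI_homs]])
    also have "\<dots> = (\<Sum>p\<in>P. card {f \<in> FI_homs k n. FI_pattern k f = p})"
      using n0(2)[of n] n S_eq by (intro sum.cong) auto
    also have "\<dots> = (\<Sum>p\<in>P. \<Prod>i<z p. n - k - i)"
    proof (rule sum.cong)
      fix p assume p: "p \<in> P"
      show "card {f \<in> FI_homs k n. FI_pattern k f = p} = (\<Prod>i<z p. n - k - i)"
        using card_FI_pattern_fibre[of "r p" k n0 n] sub r(1)[OF p] \<open>k \<le> n\<close>
        unfolding z_def r(2)[OF p] by blast
    qed simp
    finally have c: "card (S n) = (\<Sum>p\<in>P. \<Prod>i<z p. n - k - i)" .
    have "k + z p \<le> n" for p using z[of p] n by linarith
    then have "poly ?q (int n) = (\<Sum>p\<in>P. int (\<Prod>i<z p. n - k - i))"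
      by (simp add: poly_sum poly_falling_poly)
    with c show ?thesis by simp
  qed
  then have "\<forall>\<^sub>F n in sequentially. int (card (S n)) = poly ?q (int n)"
    by (rule eventually_sequentiallyI)
  moreover have "degree ?q \<le> k"
    using z \<open>finite P\<close> by (intro degree_sum_le) (auto simp: degree_falling_poly)
  ultimately show ?thesis by blast
qed

section \<open>Finite FI-sets\<close>

locale fi_set =
  fixes X :: "nat \<Rightarrow> 'x set"
    and M :: "nat \<Rightarrow> nat \<Rightarrow> (nat \<Rightarrow> nat) \<Rightarrow> 'x \<Rightarrow> 'x"
  assumes finite_obj: "finite (X n)"
    and map_comp: "\<lbrakk>f \<in> FI_homs l m; g \<in> FI_homs m n; x \<in> X l\<rbrakk> \<Longrightarrow>
      M l n (compose {1..l} g f) x = M m n g (M l m f x)"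
begin

text \<open>A permutation taking \<open>f\<close> to \<open>f'\<close> carries one fibre injectively
  into the other by composition. The situation is symmetric in \<open>f\<close> and
  \<open>f'\<close>, so equality follows.\<close>

lemma card_fibre_le:
  assumes f: "f \<in> FI_homs k n" and f': "f' \<in> FI_homs k n" and "z \<in> X k" "z' \<in> X k"
  shows "card {h \<in> FI_homs k n. M k n h z' = M k n f z} \<le> card {h \<in> FI_homs k n. M k n h z' = M k n f' z}"
proof -
  obtain g where g: "g \<in> FI_homs n n" "compose {1..k} g f = f'"
    using FI_homs_transitive[OF f f'] .
  show ?thesis
  proof (rule card_inj_on_le[where f = "compose {1..k} g"])
    show "inj_on (compose {1..k} g) {h \<in> FI_homs k n. M k n h z' = M k n f z}"
      using bij_FI_homs_compose[OF g(1)] by (rule inj_on_subset[OF bij_betw_imp_inj_on]) auto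
    show "compose {1..k} g ` {h \<in> FI_homs k n. M k n h z' = M k n f z}
        \<subseteq> {h \<in> FI_homs k n. M k n h z' = M k n f' z}"
    proof clarify
      fix h assume h: "h \<in> FI_homs k n" "M k n h z' = M k n f z"
      have "M k n (compose {1..k} g h) z' = M k n (compose {1..k} g f) z"
        using map_comp[OF h(1) g(1) \<open>z' \<in> X k\<close>] map_comp[OF f g(1) \<open>z \<in> X k\<close>] h(2) by simp
      with FI_homs_compose[OF h(1) g(1)] g(2)
      show "compose {1..k} g h \<in> FI_homs k n \<and> M k n (compose {1..k} g h) z' = M k n f' z"
        by simp
    qed
  qed (simp add: finite_FI_homs)
qed

lemma card_fibre_eq:
  assumes "f \<in> FI_homs k n" "f' \<in> FI_homs k n" "z \<in> X k" "z' \<in> X k"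
  shows "card {h \<in> FI_homs k n. M k n h z' = M k n f z} = card {h \<in> FI_homs k n. M k n h z' = M k n f' z}"
  using assms by (intro antisym card_fibre_le)

text \<open>An injection fixing [k] pointwise leaves the inclusion of [k] unchanged under
  composition, so it preserves the coincidence and \<open>card_FI_closed_poly\<close>
  applies.\<close>

lemma card_coincidences_poly:
  assumes "z \<in> X k" "z' \<in> X k"
  shows "\<exists>q::int poly. degree q \<le> k \<and> (\<forall>\<^sub>F n in sequentially.
    int (card {h \<in> FI_homs k n. M k n h z' = M k n (\<lambda>i\<in>{1..k}. i) z}) = poly q (int n))"
proof (rule card_FI_closed_poly)
  fix m n f g
  assume "k \<le> m" and f: "f \<in> {h \<in> FI_homs k m. M k m h z' = M k m (\<lambda>i\<in>{1..k}. i) z}"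
    and g: "g \<in> FI_homs m n" "\<And>i. i \<in> {1..k} \<Longrightarrow> g i = i"
  have "compose {1..k} g (\<lambda>i\<in>{1..k}. i) = (\<lambda>i\<in>{1..k}. i)"
    using g(2) by (auto simp: compose_def)
  then have "M k n (\<lambda>i\<in>{1..k}. i) z = M m n g (M k m (\<lambda>i\<in>{1..k}. i) z)"
    using map_comp[OF FI_homs_inclusion[OF \<open>k \<le> m\<close>] g(1) assms(1)] by simp
  also have "\<dots> = M k n (compose {1..k} g f) z'"
    using map_comp[of f k m g n z'] f g(1) assms(2) by simp
  finally show "compose {1..k} g f \<in> {h \<in> FI_homs k n. M k n h z' = M k n (\<lambda>i\<in>{1..k}. i) z}"
    using f FI_homs_compose[OF _ g(1), of f k] by simp
qed auto

text \<open>Generators are sought in \<open>X k\<close>, not in \<open>Y k\<close>: an element of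
  \<open>X k\<close> may enter \<open>Y\<close> only after being mapped to a larger level.\<close>

theorem card_subobject_poly:
  assumes sub: "\<And>n. Y n \<subseteq> X n"
    and closed: "\<And>m n f x. \<lbrakk>f \<in> FI_homs m n; x \<in> Y m\<rbrakk> \<Longrightarrow> M m n f x \<in> Y n"
    and gen: "\<And>n x. \<lbrakk>k \<le> n; x \<in> Y n\<rbrakk> \<Longrightarrow> \<exists>z\<in>X k. \<exists>f\<in>FI_homs k n. M k n f z = x"
  shows "\<exists>p::real poly. degree p \<le> k \<and> (\<forall>\<^sub>F n in sequentially. real (card (Y n)) = poly p (real n))"
proof -
  define \<iota> where "\<iota> = (\<lambda>i\<in>{1..k}. i)"
  have \<iota>: "\<iota> \<in> FI_homs k n" if "k \<le> n" for n
    using FI_homs_inclusion[OF that] by (simp add: \<iota>_def)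
  have mono: "{z\<in>X k. M k m \<iota> z \<in> Y m} \<subseteq> {z\<in>X k. M k n \<iota> z \<in> Y n}" if "k \<le> m" "m \<le> n" for m n
  proof clarify
    fix z assume z: "z \<in> X k" "M k m \<iota> z \<in> Y m"
    have "M k n \<iota> z = M m n (\<lambda>i\<in>{1..m}. i) (M k m \<iota> z)"
      using map_comp[OF \<iota>[OF that(1)] FI_homs_inclusion[OF that(2)] z(1)]
        FI_homs_compose_inclusion[OF \<iota>[OF that(1)]] by simp
    then show "M k n \<iota> z \<in> Y n"
      using closed[OF FI_homs_inclusion[OF that(2)] z(2)] by simp
  qed
  have "\<exists>n0\<ge>k. \<exists>C. \<forall>n\<ge>n0. {z\<in>X k. M k n \<iota> z \<in> Y n} = C"
    by (rule eventually_constant_subset[OF finite_obj[of k] _ mono]) auto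
  then obtain C n0 where n0: "n0 \<ge> k" "\<And>n. n \<ge> n0 \<Longrightarrow> {z\<in>X k. M k n \<iota> z \<in> Y n} = C"
    by blast
  have CX: "C \<subseteq> X k" using n0(2)[of n0] by auto
  then have finC: "finite C" using finite_obj finite_subset by blast
  \<comment> \<open>Any two injections differ by a permutation of [n], under which
    \<open>Y n\<close> is closed; so membership depends on \<open>z\<close> alone and may be tested
    at \<open>\<iota>\<close>.\<close>
  have mem_Y: "M k n f z \<in> Y n \<longleftrightarrow> z \<in> C" if "n \<ge> n0" "z \<in> X k" "f \<in> FI_homs k n" for n z f
  proof -
    have transport: "M k n f2 z \<in> Y n"
      if "M k n f1 z \<in> Y n" "f1 \<in> FI_homs k n" "f2 \<in> FI_homs k n" for f1 f2
    proof -
      obtain g where "g \<in> FI_homs n n" "compose {1..k} g f1 = f2"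
        using FI_homs_transitive \<open>f1 \<in> FI_homs k n\<close> \<open>f2 \<in> FI_homs k n\<close> by blast
      then show ?thesis
        using map_comp[of f1 k n g n z] closed[of g n n] that(1,2) \<open>z \<in> X k\<close> by metis
    qed
    have "z \<in> C \<longleftrightarrow> M k n \<iota> z \<in> Y n" using n0(2)[OF that(1)] that(2) by auto
    moreover have "\<iota> \<in> FI_homs k n" using \<iota> n0(1) that(1) by simp
    ultimately show ?thesis using transport that(3) by blast
  qed
  \<comment> \<open>The size of the fibre of the evaluation map on pairs over the image of
    \<open>z\<close> under \<open>\<iota>\<close>, split by first component;
    \<open>card_fibre_eq\<close> allows any injection in place of \<open>\<iota>\<close>.\<close>
  define N where "N n z = (\<Sum>z'\<in>C. card {h \<in> FI_homs k n. M k n h z' = M k n \<iota> z})" for n z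
  have card_Y: "real (card (Y n)) = (\<Sum>z\<in>C. real (card (FI_homs k n)) / real (N n z))"
    if n: "n \<ge> n0" for n
  proof -
    define e where "e = (\<lambda>(z, f). M k n f z)"
    have fib: "card {b \<in> C \<times> FI_homs k n. e b = e (z, f)} = N n z"
      if "z \<in> C" "f \<in> FI_homs k n" for z f
    proof -
      have "{b \<in> C \<times> FI_homs k n. e b = e (z, f)} =
          (SIGMA z':C. {h \<in> FI_homs k n. M k n h z' = M k n f z})"
        by (auto simp: e_def)
      then have "card {b \<in> C \<times> FI_homs k n. e b = e (z, f)} =
          (\<Sum>z'\<in>C. card {h \<in> FI_homs k n. M k n h z' = M k n f z})"
        using finC by (simp add: card_SigmaI finite_FI_homs)
      also have "\<dots> = N n z"
        unfolding N_def
        using that CX n n0(1) by (intro sum.cong refl card_fibre_eq \<iota>) auto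
      finally show ?thesis .
    qed
    have "Y n = e ` (C \<times> FI_homs k n)"
    proof
      show "e ` (C \<times> FI_homs k n) \<subseteq> Y n"
        using mem_Y[OF n] CX by (auto simp: e_def)
      show "Y n \<subseteq> e ` (C \<times> FI_homs k n)"
      proof
        fix x assume x: "x \<in> Y n"
        have "k \<le> n" using n0(1) n by simp
        then obtain z f where "z \<in> X k" "f \<in> FI_homs k n" "M k n f z = x"
          using gen[OF _ x] by blast
        moreover from this have "z \<in> C" using mem_Y[OF n] x by blast
        ultimately show "x \<in> e ` (C \<times> FI_homs k n)" by (force simp: e_def)
      qed
    qed
    then have "real (card (Y n)) = (\<Sum>a\<in>C \<times> FI_homs k n. 1 / real (card {b \<in> C \<times> FI_homs k n. e b = e a}))"
      using card_image_sum_fibres[of "C \<times> FI_homs k n" e] finC finite_FI_homs by simp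
    also have "\<dots> = (\<Sum>(z, f)\<in>C \<times> FI_homs k n. 1 / real (N n z))"
      by (rule sum.cong[OF refl]) (auto simp: fib)
    also have "\<dots> = (\<Sum>z\<in>C. real (card (FI_homs k n)) / real (N n z))"
      by (simp add: sum.cartesian_product[symmetric])
    finally show ?thesis .
  qed
  \<comment> \<open>The pair of \<open>z\<close> and \<open>\<iota>\<close> lies in its own
    fibre.\<close>
  have N_pos: "N n z > 0" if "n \<ge> n0" "z \<in> C" for n z
  proof -
    have "\<iota> \<in> {h \<in> FI_homs k n. M k n h z = M k n \<iota> z}" using \<iota> n0(1) that(1) by simp
    then have "card {h \<in> FI_homs k n. M k n h z = M k n \<iota> z} > 0"
      by (subst card_gt_0_iff) (auto simp: finite_FI_homs)
    then show ?thesis unfolding N_def using finC that(2) by (intro sum_pos2) auto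
  qed
  have "\<forall>z\<in>C. \<exists>q::int poly. \<forall>\<^sub>F n in sequentially. int (N n z) = poly q (int n)"
  proof
    fix z assume "z \<in> C"
    have "\<forall>z'\<in>C. \<exists>q::int poly. \<forall>\<^sub>F n in sequentially.
        int (card {h \<in> FI_homs k n. M k n h z' = M k n \<iota> z}) = poly q (int n)"
      using card_coincidences_poly[of z k] CX \<open>z \<in> C\<close> unfolding \<iota>_def by blast
    from bchoice[OF this] obtain q :: "'x \<Rightarrow> int poly" where "\<forall>z'\<in>C. \<forall>\<^sub>F n in sequentially.
        int (card {h \<in> FI_homs k n. M k n h z' = M k n \<iota> z}) = poly (q z') (int n)"
      by blast
    then have "\<forall>\<^sub>F n in sequentially. \<forall>z'\<in>C.
        int (card {h \<in> FI_homs k n. M k n h z' = M k n \<iota> z}) = poly (q z') (int n)"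
      using finC by (simp add: eventually_ball_finite)
    then have "\<forall>\<^sub>F n in sequentially. int (N n z) = poly (\<Sum>z'\<in>C. q z') (int n)"
      by eventually_elim (simp add: N_def poly_sum)
    then show "\<exists>q::int poly. \<forall>\<^sub>F n in sequentially. int (N n z) = poly q (int n)"
      by blast
  qed
  from bchoice[OF this] obtain q :: "'x \<Rightarrow> int poly" where
    "\<forall>z\<in>C. \<forall>\<^sub>F n in sequentially. int (N n z) = poly (q z) (int n)"
    by blast
  then have q: "\<forall>\<^sub>F n in sequentially. \<forall>z\<in>C. int (N n z) = poly (q z) (int n)"
    using finC by (simp add: eventually_ball_finite)
  obtain r :: "int poly" where r: "degree r \<le> k"
    "\<forall>\<^sub>F n in sequentially. int (card (FI_homs k n)) = poly r (int n)"
    using card_FI_closed_poly[of "FI_homs k" k] FI_homs_compose by blast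
  have q_nz: "q z \<noteq> 0" if "z \<in> C" for z
  proof
    assume "q z = 0"
    have "\<forall>\<^sub>F n::nat in sequentially. False"
      using q eventually_ge_at_top[of n0]
    proof eventually_elim
      case (elim n)
      then show ?case using N_pos[of n z] that \<open>q z = 0\<close> by fastforce
    qed
    then show False by simp
  qed
  \<comment> \<open>\<open>Q\<close> is a common denominator and \<open>P\<close> the matching
    numerator of the sum of \<open>r\<close> / \<open>q z\<close> over \<open>C\<close>. Each
    summand of \<open>P\<close> is \<open>r\<close> times a divisor of \<open>Q\<close>, so the
    degree of \<open>P\<close> exceeds that of \<open>Q\<close> by at most k.\<close>
  define Q where "Q = (\<Prod>z\<in>C. q z)"
  define P where "P = (\<Sum>z\<in>C. r * (\<Prod>z'\<in>C - {z}. q z'))"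
  have Q_nz: "Q \<noteq> 0" using q_nz finC by (simp add: Q_def)
  have "degree P \<le> k + degree Q"
    unfolding P_def
  proof (rule degree_sum_le[OF finC])
    fix z assume "z \<in> C"
    have "degree (\<Prod>z'\<in>C - {z}. q z') \<le> degree Q"
      using Q_nz finC \<open>z \<in> C\<close> prod.remove[of C z q] by (intro dvd_imp_degree_le) (simp_all add: Q_def)
    then show "degree (r * (\<Prod>z'\<in>C - {z}. q z')) \<le> k + degree Q"
      using degree_mult_le[of r "\<Prod>z'\<in>C - {z}. q z'"] r(1) by linarith
  qed
  moreover have "\<forall>\<^sub>F n in sequentially. int (card (Y n)) * poly Q (int n) = poly P (int n)"
    using q r(2) eventually_ge_at_top[of n0]
  proof eventually_elim
    case (elim n)
    have "real_of_int (int (card (Y n)) * poly Q (int n)) =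
        (\<Sum>z\<in>C. real (card (FI_homs k n)) / real (N n z) * (\<Prod>z\<in>C. real (N n z)))"
      using elim(1) card_Y[OF elim(3)]
      by (simp add: Q_def poly_prod sum_distrib_right flip: elim(1))
    also have "\<dots> = (\<Sum>z\<in>C. real (card (FI_homs k n)) * (\<Prod>z'\<in>C - {z}. real (N n z')))"
    proof (rule sum.cong[OF refl])
      fix z assume z: "z \<in> C"
      show "real (card (FI_homs k n)) / real (N n z) * (\<Prod>z\<in>C. real (N n z)) =
          real (card (FI_homs k n)) * (\<Prod>z'\<in>C - {z}. real (N n z'))"
        using N_pos[OF elim(3) z] prod.remove[OF finC z, of "\<lambda>z. real (N n z)"] by simp
    qed
    also have "\<dots> = real_of_int (\<Sum>z\<in>C. int (card (FI_homs k n)) * (\<Prod>z'\<in>C - {z}. int (N n z')))"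
      by simp
    also have "(\<Sum>z\<in>C. int (card (FI_homs k n)) * (\<Prod>z'\<in>C - {z}. int (N n z'))) = poly P (int n)"
      using elim(1,2) by (simp add: P_def poly_sum poly_prod)
    finally show ?case by (simp only: of_int_eq_iff)
  qed
  ultimately show ?thesis
    using integer_valued_ratio_is_poly[OF Q_nz, of "\<lambda>n. int (card (Y n))" P] by force
qed

end

section \<open>FI-graphs\<close>

context fi_graph
begin

lemma map_vertex: "f \<in> FI_homs m n \<Longrightarrow> v \<in> pverts (G m) \<Longrightarrow> F m n f v \<in> pverts (G n)"
  using map_hom[of f m n] by (auto simp: graph_homs_def)

lemma map_comp_apply:
  assumes "f \<in> FI_homs l m" "g \<in> FI_homs m n" "v \<in> pverts (G l)"
  shows "F l n (compose {1..l} g f) v = F m n g (F l m f v)"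
  using map_comp[OF assms(1,2)] assms(3) by (simp add: compose_eq)

text \<open>Stability is iterated from level d upwards, and functoriality merges the successive
  injections into one.\<close>

lemma vertex_generated:
  assumes "vertex_stable G F d" "d \<le> n" "v \<in> pverts (G n)"
  shows "\<exists>u\<in>pverts (G d). \<exists>f\<in>FI_homs d n. F d n f u = v"
  using assms(2,3)
proof (induction arbitrary: v rule: dec_induct)
  case base
  then have "F d d (\<lambda>i\<in>{1..d}. i) v = v" using map_id[of d] by (metis restrict_apply')
  with base FI_homs_inclusion[of d d] show ?case by blast
next
  case (step n)
  have "\<exists>w\<in>pverts (G n). \<exists>f\<in>FI_homs n (n + 1). F n (n + 1) f w = v"
    using assms(1) step.hyps(1) step.prems by (simp add: vertex_stable_def)
  then obtain w f where w: "w \<in> pverts (G n)" and f: "f \<in> FI_homs n (Suc n)" "F n (Suc n) f w = v"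
    by auto
  obtain u f' where u: "u \<in> pverts (G d)" and f': "f' \<in> FI_homs d n" "F d n f' u = w"
    using step.IH[OF w] by blast
  have "F d (Suc n) (compose {1..d} f f') u = v"
    using map_comp_apply[OF f'(1) f(1) u] f f' by simp
  with u FI_homs_compose[OF f'(1) f(1)] show ?case by blast
qed

lemma graph_homs_map:
  assumes "pair_graph T" "f \<in> FI_homs m n" "\<phi> \<in> graph_homs T (G m)"
  shows "compose (pverts T) (F m n f) \<phi> \<in> graph_homs T (G n)"
proof -
  interpret T: pair_graph T by fact
  have "F m n f \<in> graph_homs (G m) (G n)" using map_hom[OF assms(2)] .
  with assms(3) show ?thesis
    unfolding graph_homs_def
    by (auto simp: compose_def T.in_arcsD1 T.in_arcsD2)
qed

text \<open>Each value of \<open>\<phi>\<close> comes from level d along an injection with d image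
  points. Together these images occupy at most \<open>card I * d\<close> points of [n], so all the
  injections factor through a single one from [\<open>card I * d\<close>].\<close>

lemma vertex_maps_generated:
  assumes "vertex_stable G F d" "finite I" "card I * d \<le> n" "\<phi> \<in> I \<rightarrow>\<^sub>E pverts (G n)"
  shows "\<exists>\<psi>\<in>I \<rightarrow>\<^sub>E pverts (G (card I * d)). \<exists>h\<in>FI_homs (card I * d) n.
    compose I (F (card I * d) n h) \<psi> = \<phi>"
proof -
  define D where "D = card I * d"
  have d_le: "d \<le> n" if "t \<in> I" for t
  proof -
    have "card I \<noteq> 0" using that assms(2) by auto
    then have "d \<le> card I * d" by simp
    with assms(3) show ?thesis by linarith
  qed
  have "\<forall>t\<in>I. \<exists>u f. u \<in> pverts (G d) \<and> f \<in> FI_homs d n \<and> F d n f u = \<phi> t"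
    using vertex_generated[OF assms(1) d_le] assms(4) by blast
  then obtain u f where u: "\<And>t. t \<in> I \<Longrightarrow> u t \<in> pverts (G d)"
    and f: "\<And>t. t \<in> I \<Longrightarrow> f t \<in> FI_homs d n" and uf: "\<And>t. t \<in> I \<Longrightarrow> F d n (f t) (u t) = \<phi> t"
    by metis
  define U where "U = (\<Union>t\<in>I. f t ` {1..d})"
  have "card U \<le> (\<Sum>t\<in>I. card (f t ` {1..d}))"
    unfolding U_def by (rule card_UN_le[OF assms(2)])
  also have "\<dots> \<le> (\<Sum>t\<in>I. d)"
    by (rule sum_mono) (metis card_image_le card_atLeastAtMost finite_atLeastAtMost diff_Suc_1)
  finally have "card U \<le> D" by (simp add: D_def)
  moreover have "U \<subseteq> {1..n}" using FI_homs_mem[OF f] by (auto simp: U_def)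
  moreover have "D \<le> card {1..n}" using assms(3) by (simp add: D_def)
  \<comment> \<open>The union of images may be too small, so it is padded to exactly
    \<open>D\<close> points, which \<open>h\<close> then enumerates.\<close>
  ultimately obtain W where W: "U \<subseteq> W" "W \<subseteq> {1..n}" "card W = D"
    using exists_subset_between[of U D "{1..n}"] by auto
  have "finite W" using W(2) finite_subset by blast
  then obtain b where b: "bij_betw b {1..D} W"
    using finite_same_card_bij[of "{1..D}" W] W(3) by auto
  define h where "h = restrict b {1..D}"
  have h: "bij_betw h {1..D} W"
    using b by (subst bij_betw_cong[of _ h b]) (auto simp: h_def)
  have h_FI: "h \<in> FI_homs D n"
  proof (rule FI_homsI)
    show "h \<in> {1..D} \<rightarrow>\<^sub>E {1..n}"
      using bij_betw_apply[OF h] W(2) by (intro PiE_I) (blast, auto simp: h_def)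
  qed (rule bij_betw_imp_inj_on[OF h])
  \<comment> \<open>The factor of \<open>f t\<close> through \<open>h\<close>, obtained by inverting
    \<open>h\<close> on \<open>W\<close>.\<close>
  define f' where "f' t = (\<lambda>i\<in>{1..d}. inv_into {1..D} h (f t i))" for t
  have fW: "f t i \<in> W" if "t \<in> I" "i \<in> {1..d}" for t i
    using that W(1) unfolding U_def by blast
  have hf': "h (f' t i) = f t i" if "t \<in> I" "i \<in> {1..d}" for t i
    using bij_betw_inv_into_right[OF h fW[OF that]] that(2) by (simp add: f'_def)
  have f'_FI: "f' t \<in> FI_homs d D" if t: "t \<in> I" for t
  proof (rule FI_homsI)
    have "f' t i \<in> {1..D}" if "i \<in> {1..d}" for i
      using bij_betw_apply[OF bij_betw_inv_into[OF h] fW[OF t that]] that by (simp add: f'_def)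
    then show "f' t \<in> {1..d} \<rightarrow>\<^sub>E {1..D}"
      by (intro PiE_I) (auto simp: f'_def)
    show "inj_on (f' t) {1..d}"
      using hf'[OF t] FI_homsD(2)[OF f[OF t]] by (metis inj_on_def)
  qed
  define \<psi> where "\<psi> = (\<lambda>t\<in>I. F d D (f' t) (u t))"
  have "\<psi> \<in> I \<rightarrow>\<^sub>E pverts (G D)"
    using map_vertex[OF f'_FI u] by (auto simp: \<psi>_def)
  moreover have "compose I (F D n h) \<psi> = \<phi>"
  proof (rule extensionalityI[where A = I])
    show "\<phi> \<in> extensional I" using assms(4) by (auto simp: PiE_iff)
    fix t assume t: "t \<in> I"
    have "compose {1..d} h (f' t) = f t"
      by (rule FI_homs_eqI[OF FI_homs_compose[OF f'_FI[OF t] h_FI] f[OF t]])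
        (simp add: compose_eq hf'[OF t])
    then have "F D n h (F d D (f' t) (u t)) = F d n (f t) (u t)"
      using map_comp_apply[OF f'_FI[OF t] h_FI u[OF t]] by simp
    then show "compose I (F D n h) \<psi> t = \<phi> t"
      using t by (simp add: compose_eq \<psi>_def uf)
  qed (rule compose_extensional)
  ultimately show ?thesis using h_FI unfolding D_def by blast
qed

end

theorem corollary6:
  fixes G :: "nat \<Rightarrow> 'a pair_pre_digraph"
    and F :: "nat \<Rightarrow> nat \<Rightarrow> (nat \<Rightarrow> nat) \<Rightarrow> 'a \<Rightarrow> 'a"
    and T :: "'t pair_pre_digraph"
    and d :: nat
  assumes "fi_graph G F"
    and "vertex_stable G F d"
    and "pair_graph T"
  shows "\<exists>p :: real poly. degree p \<le> card (pverts T) * d \<and>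
    (\<forall>\<^sub>F n in sequentially. real (card (graph_homs T (G n))) = poly p (real n))"
proof -
  interpret fi_graph G F by fact
  interpret T: pair_graph T by fact
  have finite_G: "finite (pverts (G n))" for n
    using graph_obj[of n] by (simp add: pair_graph_def pair_digraph_def pair_fin_digraph.pair_finite_verts)
  interpret maps: fi_set "\<lambda>n. pverts T \<rightarrow>\<^sub>E pverts (G n)" "\<lambda>m n f. compose (pverts T) (F m n f)"
  proof
    fix l m n f g and x :: "'t \<Rightarrow> 'a"
    assume f: "f \<in> FI_homs l m" "g \<in> FI_homs m n" and x: "x \<in> pverts T \<rightarrow>\<^sub>E pverts (G l)"
    then show "compose (pverts T) (F l n (compose {1..l} g f)) x =
        compose (pverts T) (F m n g) (compose (pverts T) (F l m f) x)"
      using map_comp_apply[OF f] unfolding compose_def by (intro restrict_ext) auto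
  qed (simp add: finite_G finite_PiE)
  show ?thesis
  \<comment> \<open>The generator of a homomorphism is only a vertex map and need not preserve
    edges, which the generation hypothesis permits.\<close>
  proof (rule maps.card_subobject_poly)
    show "graph_homs T (G n) \<subseteq> pverts T \<rightarrow>\<^sub>E pverts (G n)" for n
      by (auto simp: graph_homs_def)
    then show "\<exists>z\<in>pverts T \<rightarrow>\<^sub>E pverts (G (card (pverts T) * d)). \<exists>f\<in>FI_homs (card (pverts T) * d) n.
        compose (pverts T) (F (card (pverts T) * d) n f) z = x"
      if "card (pverts T) * d \<le> n" "x \<in> graph_homs T (G n)" for n x
      using that by (intro vertex_maps_generated[OF assms(2)]) auto
  qed (rule graph_homs_map[OF assms(3)])
qed

end
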